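(* Let $(W,S)$ be a Coxeter system of rank $3$ (that is, $|S|=3$) and let $c\in W$ be a Coxeter element. Then the poset $[1,c]_T$ is a lattice.
   Context: $T=\bigcup_{w\in W} wSw^{-1}$ is the set of reflections of $W$. The reflection length $\ell_T(w)$ is the smallest $k\ge 0$ such that $w$ is a product of $k$ elements of $T$. The absolute order is the partial order on $W$ defined by $u\leq_T v \iff \ell_T(u)+\ell_T(u^{-1}v)=\ell_T(v)$. A Coxeter element is a product of all the elements of $S$, each occurring exactly once, in some order. $[1,c]_T=\{x\in W\mid x\leq_T c\}$, ordered by $\leq_T$. *)

theory Defs
  imports "HOL-Algebra.Generated_Groups" "HOL-Library.Extended_Nat"
begin

text \<open>A letter (s, True) stands for the generator s, and (s, False) for its formal inverse.\<close>

type_synonym 'a word = "('a \<times> bool) list"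

definition list_product :: "('a, 'b) monoid_scheme \<Rightarrow> 'a list \<Rightarrow> 'a" where
  "list_product G xs = foldr (\<otimes>\<^bsub>G\<^esub>) xs \<one>\<^bsub>G\<^esub>"

definition word_value :: "('a, 'b) monoid_scheme \<Rightarrow> 'a word \<Rightarrow> 'a" where
  "word_value G w = list_product G (map (\<lambda>(s, e). if e then s else inv\<^bsub>G\<^esub> s) w)"

text \<open>Words over S that are connected by the moves below are exactly those representing the same
  element of the abstract group with generators S and relations r = 1 for r in R.\<close>

inductive word_move :: "'a set \<Rightarrow> 'a word set \<Rightarrow> 'a word \<Rightarrow> 'a word \<Rightarrow> bool"
  for S :: "'a set" and R :: "'a word set" where
  cancel: "s \<in> S \<Longrightarrow> word_move S R (u @ [(s, e), (s, \<not> e)] @ v) (u @ v)"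
| relator: "r \<in> R \<Longrightarrow> word_move S R (u @ r @ v) (u @ v)"

text \<open>The evaluation map from that abstract group to G is required to be well defined and
  injective (last clause) and surjective (second clause).\<close>

definition has_presentation :: "('a, 'b) monoid_scheme \<Rightarrow> 'a set \<Rightarrow> 'a word set \<Rightarrow> bool" where
  "has_presentation G S R \<longleftrightarrow>
     S \<subseteq> carrier G \<and>
     generate G S = carrier G \<and>
     (\<forall>w \<in> lists (S \<times> UNIV). word_value G w = \<one>\<^bsub>G\<^esub> \<longleftrightarrow> equivclp (word_move S R) w [])"

definition coxeter_matrix :: "'a set \<Rightarrow> ('a \<Rightarrow> 'a \<Rightarrow> enat) \<Rightarrow> bool" where
  "coxeter_matrix S m \<longleftrightarrow>
     (\<forall>s \<in> S. m s s = 1) \<and>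
     (\<forall>s \<in> S. \<forall>t \<in> S. m s t = m t s) \<and>
     (\<forall>s \<in> S. \<forall>t \<in> S. s \<noteq> t \<longrightarrow> 2 \<le> m s t)"

text \<open>There is no relator for a pair with m s t infinite; the diagonal gives the relators ss.\<close>

definition coxeter_relators :: "'a set \<Rightarrow> ('a \<Rightarrow> 'a \<Rightarrow> enat) \<Rightarrow> 'a word set" where
  "coxeter_relators S m =
     {concat (replicate k [(s, True), (t, True)]) | s t k. s \<in> S \<and> t \<in> S \<and> m s t = enat k}"

locale coxeter_system = group W for W (structure) +
  fixes S :: "'a set"
  assumes coxeter_presentation:
    "\<exists>m. coxeter_matrix S m \<and> has_presentation W S (coxeter_relators S m)"

definition reflections :: "('a, 'b) monoid_scheme \<Rightarrow> 'a set \<Rightarrow> 'a set" where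
  "reflections W S = {w \<otimes>\<^bsub>W\<^esub> s \<otimes>\<^bsub>W\<^esub> inv\<^bsub>W\<^esub> w | w s. w \<in> carrier W \<and> s \<in> S}"

definition reflection_length :: "('a, 'b) monoid_scheme \<Rightarrow> 'a set \<Rightarrow> 'a \<Rightarrow> nat" where
  "reflection_length W S w =
     (LEAST k. \<exists>ts \<in> lists (reflections W S). length ts = k \<and> list_product W ts = w)"

definition absolute_le :: "('a, 'b) monoid_scheme \<Rightarrow> 'a set \<Rightarrow> 'a \<Rightarrow> 'a \<Rightarrow> bool" where
  "absolute_le W S u v \<longleftrightarrow>
     reflection_length W S u + reflection_length W S (inv\<^bsub>W\<^esub> u \<otimes>\<^bsub>W\<^esub> v) = reflection_length W S v"

definition coxeter_element :: "('a, 'b) monoid_scheme \<Rightarrow> 'a set \<Rightarrow> 'a \<Rightarrow> bool" where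
  "coxeter_element W S c \<longleftrightarrow> (\<exists>ss. distinct ss \<and> set ss = S \<and> list_product W ss = c)"

definition absolute_interval :: "('a, 'b) monoid_scheme \<Rightarrow> 'a set \<Rightarrow> 'a \<Rightarrow> 'a gorder" where
  "absolute_interval W S c =
     \<lparr>carrier = {x \<in> carrier W. absolute_le W S x c}, eq = (=), le = absolute_le W S\<rparr>"

end

theory Submission
  imports Defs "HOL-Analysis.Cross3"
begin

text \<open>
  Rank the interval by reflection length. A Coxeter element of a rank three group is a product of
  three reflections, so the interval is a bounded poset of rank at most three, and such a poset is a
  lattice unless it contains a bowtie: two elements of rank one that both lie below two different
  elements of rank two (\<open>lattice_of_rank_three\<close>). The point is to exclude bowties.

  This is done by linear algebra. Represent the group by \<open>3 \<times> 3\<close> matrices under the circle product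
  \<open>M \<odot> N = M + N - M A N\<close>, where \<open>A\<close> is the Cartan matrix and the generator \<open>s\<^sub>i\<close> goes to the matrix
  unit \<open>E\<^sub>i\<^sub>i\<close>. This is the geometric representation with the coroots kept formally independent, so
  that a degenerate \<open>A\<close> (affine groups) does no harm. Every reflection goes to \<open>b b\<^sup>T\<close> for a root \<open>b\<close>,
  and the Coxeter element goes to an invertible matrix \<open>C\<close> (\<open>coxeter_word_nonsingular\<close>).

  Suppose \<open>c = s a r\<close> with reflections \<open>s\<close>, \<open>a\<close>, \<open>r\<close>. A nonzero covector \<open>f\<close> orthogonal to the roots of \<open>s\<close>
  and \<open>a\<close> satisfies \<open>f C \<in> \<real> r\<close>, where a reflection stands for its root. If also \<open>c = t b r\<close>, the
  covector obtained from \<open>t\<close> and \<open>b\<close> has an image on the same line, so it is proportional to \<open>f\<close>,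
  and \<open>f\<close> is orthogonal to the roots of both \<open>s\<close> and \<open>t\<close>. If \<open>s \<noteq> t\<close>, these roots span a plane, so the
  line of \<open>f\<close>, and with it the line of \<open>r\<close>, is determined by \<open>s\<close>, \<open>t\<close> and \<open>C\<close>.
  Two elements \<open>s a = t b\<close> and \<open>s a' = t b'\<close> of rank two therefore have complements \<open>r\<close> and \<open>r'\<close> with proportional roots (\<open>no_bowtie\<close>).

  To conclude \<open>r = r'\<close> in the abstract group one needs that reflections are determined by their roots,
  and hence that the representation is faithful. This is Tits' theorem \<open>word_rep_faithful\<close>; it is
  proved by his positivity argument (\<open>root_image_nonneg\<close>).
\<close>

section \<open>Rank one matrices and the circle product\<close>

definition rank_one :: "real^'n \<Rightarrow> real^'n \<Rightarrow> real^'n^'n" where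
  "rank_one x y = (\<chi> i j. x $ i * y $ j)"

lemma rank_one_mult_left: "M ** rank_one x y = rank_one (M *v x) y"
  by (simp add: rank_one_def matrix_matrix_mult_def matrix_vector_mult_def vec_eq_iff
      sum_distrib_right mult.assoc)

lemma rank_one_mult_right: "rank_one x y ** M = rank_one x (y v* M)"
  by (simp add: rank_one_def matrix_matrix_mult_def vector_matrix_mult_def vec_eq_iff
      sum_distrib_left mult_ac)

lemma rank_one_vector: "rank_one x y *v z = (y \<bullet> z) *\<^sub>R x"
  by (simp add: rank_one_def matrix_vector_mult_def inner_vec_def vec_eq_iff sum_distrib_left
      sum_distrib_right mult_ac)

lemma vector_rank_one: "z v* rank_one x y = (z \<bullet> x) *\<^sub>R y"
  by (simp add: rank_one_def vector_matrix_mult_def inner_vec_def vec_eq_iff sum_distrib_left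
      sum_distrib_right mult_ac)

lemma transpose_rank_one: "transpose (rank_one x y) = rank_one y x"
  by (simp add: rank_one_def transpose_def vec_eq_iff mult_ac)

lemma rank_one_scaleR: "rank_one (k *\<^sub>R x) (k *\<^sub>R x) = k\<^sup>2 *\<^sub>R rank_one x x"
  by (simp add: rank_one_def vec_eq_iff power2_eq_square)

lemma rank_one_zero [simp]: "rank_one 0 y = 0"
  by (simp add: rank_one_def vec_eq_iff)

text \<open>Composition of maps, read off in coordinates. Take formal roots \<open>\<alpha>\<^sub>i\<close> and formal, linearly
  independent coroots \<open>\<alpha>\<^sub>i\<^sup>*\<close> that pair by \<open>\<alpha>\<^sub>i\<^sup>*(\<alpha>\<^sub>j) = A\<^sub>i\<^sub>j\<close>. The product of two maps of the form
  \<open>1 - \<Sum> M\<^sub>i\<^sub>j \<alpha>\<^sub>i \<otimes> \<alpha>\<^sub>j\<^sup>*\<close> is again of this form, and its matrix is the circle product. As the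
  coroots are independent, the map determines \<open>M\<close> even if \<open>A\<close> is singular.\<close>
definition circle :: "real^'n^'n \<Rightarrow> real^'n^'n \<Rightarrow> real^'n^'n \<Rightarrow> real^'n^'n" where
  "circle A M N = M + N - M ** A ** N"

lemma matrix_diff_ldistrib: "M ** (N - K) = M ** N - M ** (K :: real^'n^'m)"
  by (simp add: matrix_matrix_mult_def vec_eq_iff right_diff_distrib sum_subtractf)

lemma matrix_diff_rdistrib: "(N - K) ** M = N ** M - (K :: real^'n^'m) ** M"
  by (simp add: matrix_matrix_mult_def vec_eq_iff left_diff_distrib sum_subtractf)

lemma matrix_add_rdistrib: "(N + K) ** M = N ** M + (K :: real^'n^'m) ** M"
  by (simp add: matrix_matrix_mult_def vec_eq_iff distrib_right sum.distrib)

lemma matrix_zero_mult: "(0 :: real^'n^'m) ** M = 0" "N ** (0 :: real^'n^'m) = 0"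
  by (simp_all add: matrix_matrix_mult_def vec_eq_iff)

lemmas matrix_distribs = matrix_add_ldistrib matrix_add_rdistrib
  matrix_diff_ldistrib matrix_diff_rdistrib matrix_mul_assoc

lemma circle_assoc: "circle A (circle A M N) K = circle A M (circle A N K)"
  by (simp add: circle_def matrix_distribs)

lemma circle_zero [simp]: "circle A 0 M = M" "circle A M 0 = M"
  by (simp_all add: circle_def matrix_zero_mult)

lemma transpose_diff: "transpose (X - Y) = transpose X - transpose (Y :: real^'n^'m)"
  by (simp add: transpose_def vec_eq_iff)

lemma transpose_circle:
  assumes "transpose A = A"
  shows "transpose (circle A M N) = circle A (transpose N) (transpose M)"
proof -
  have "transpose (X + Y) = transpose X + transpose Y" for X Y :: "real^'n^'n"
    by (simp add: transpose_def vec_eq_iff)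
  then show ?thesis
    by (simp add: circle_def transpose_diff matrix_transpose_mul assms matrix_mul_assoc add.commute)
qed

text \<open>A covector that kills the left factor does not see it. Applied to a product of reflections
  \<open>b b\<^sup>T\<close>, a covector orthogonal to all roots but the last sees only the last reflection.\<close>
lemma vector_circle_absorb:
  assumes "f v* M = 0"
  shows "f v* circle A M N = f v* N"
  using assms by (simp add: circle_def vector_matrix_mult_diff_rdistrib
      vector_matrix_mult_add_rdistrib flip: vector_matrix_mul_assoc)

text \<open>The linear action on the span of the roots. It forgets the part of \<open>M\<close> that is killed by \<open>A\<close>.\<close>
definition action_matrix :: "real^'n^'n \<Rightarrow> real^'n^'n \<Rightarrow> real^'n^'n" where
  "action_matrix A M = mat 1 - M ** A"

lemma action_matrix_circle:
  "action_matrix A (circle A M N) = action_matrix A M ** action_matrix A N"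
  by (simp add: action_matrix_def circle_def matrix_distribs)

text \<open>Conjugates of a reflection are again of the form \<open>b b\<^sup>T\<close>: since \<open>A\<close> is symmetric, the root and
  the coroot of a reflection are moved by the same matrix and have the same coordinates.\<close>
lemma circle_conjugate:
  assumes "transpose A = A" "circle A M N = 0" "N = transpose M"
  shows "circle A (circle A M (rank_one x x)) N =
    rank_one (action_matrix A M *v x) (action_matrix A M *v x)"
proof -
  have tr: "transpose (action_matrix A M) = mat 1 - A ** N"
    by (metis action_matrix_def assms(1,3) matrix_transpose_mul transpose_mat transpose_diff)
  have zero: "M + N - M ** A ** N = 0"
    using assms(2) by (simp add: circle_def)
  have "circle A (circle A M (rank_one x x)) N
      = (M + N - M ** A ** N) + action_matrix A M ** rank_one x x ** transpose (action_matrix A M)"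
    by (simp add: tr) (simp add: circle_def action_matrix_def matrix_distribs)
  also have "action_matrix A M ** rank_one x x ** transpose (action_matrix A M) =
     rank_one (action_matrix A M *v x) (action_matrix A M *v x)"
    by (simp only: rank_one_mult_left rank_one_mult_right) (simp flip: transpose_matrix_vector)
  finally show ?thesis by (simp add: zero)
qed

text \<open>An involution satisfies \<open>M A M = 2 M\<close>, which is quadratic on the left and linear on the right;
  this leaves no room for rescaling.\<close>
lemma circle_involution_proportional:
  assumes "circle A M M = 0" "circle A N N = 0" "M = \<mu> *\<^sub>R N" "\<mu> \<noteq> 0"
  shows "M = N"
proof -
  have n: "N ** A ** N = 2 *\<^sub>R N" and m: "M ** A ** M = 2 *\<^sub>R M"
    using assms(1,2) by (simp_all add: circle_def scaleR_2)
  have "M ** A ** M = \<mu>\<^sup>2 *\<^sub>R (N ** A ** N)"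
    by (simp add: assms(3) matrix_matrix_mult_def vec_eq_iff sum_distrib_left sum_distrib_right
        power2_eq_square mult_ac)
  then have "(2 * \<mu>\<^sup>2) *\<^sub>R N = (2 * \<mu>) *\<^sub>R N"
    using n m assms(3) by (simp add: mult.commute)
  then have "N = 0 \<or> \<mu> = 1"
    using assms(4) by (auto simp add: power2_eq_square)
  then show ?thesis using assms(3) by auto
qed

section \<open>Roots of dihedral groups\<close>

text \<open>The coefficients of the roots of a dihedral group: with \<open>a = - 2 cos \<theta>\<close> the \<open>n\<close>-th value is
  \<open>sin (n \<theta>) / sin \<theta>\<close>. The recurrence also covers the infinite dihedral group, where the
  value is \<open>n\<close>.\<close>
fun chebyshev :: "real \<Rightarrow> nat \<Rightarrow> real" where
  "chebyshev a 0 = 0"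
| "chebyshev a (Suc 0) = 1"
| "chebyshev a (Suc (Suc n)) = - a * chebyshev a (Suc n) - chebyshev a n"

text \<open>A conserved quantity of the recurrence: all roots are as long as the simple ones.\<close>
lemma chebyshev_invariant:
  "(chebyshev a (Suc n))\<^sup>2 + a * chebyshev a n * chebyshev a (Suc n) + (chebyshev a n)\<^sup>2 = 1"
  by (induction n) (simp_all add: power2_eq_square algebra_simps)

lemma chebyshev_sin:
  "chebyshev (- 2 * cos \<theta>) n * sin \<theta> = sin (real n * \<theta>)"
proof (induction "- 2 * cos \<theta>" n rule: chebyshev.induct)
  case (3 n)
  have "sin (real (Suc (Suc n)) * \<theta>) + sin (real n * \<theta>)
      = sin (real (Suc n) * \<theta> + \<theta>) + sin (real (Suc n) * \<theta> - \<theta>)"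
    by (simp add: algebra_simps)
  also have "\<dots> = 2 * cos \<theta> * sin (real (Suc n) * \<theta>)"
    unfolding sin_add sin_diff by simp
  finally show ?case
    using 3 by (simp add: left_diff_distrib mult.assoc)
qed simp_all

lemma chebyshev_minus_two: "chebyshev (- 2) n = real n"
  by (induction "- 2 :: real" n rule: chebyshev.induct) (simp_all add: algebra_simps)

definition cartan_entry :: "enat \<Rightarrow> real" where
  "cartan_entry k = (case k of enat k \<Rightarrow> - 2 * cos (pi / real k) | \<infinity> \<Rightarrow> - 2)"

lemma cartan_entry_one: "cartan_entry 1 = 2"
  by (simp add: cartan_entry_def one_enat_def)

lemma sin_pi_over_pos:
  assumes "2 \<le> k"
  shows "0 < sin (pi / real k)"
proof (rule sin_gt_zero)
  show "pi / real k < pi"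
    using assms by (simp add: divide_less_eq)
qed (use assms in simp)

lemma chebyshev_cartan_zero:
  assumes "2 \<le> k"
  shows "chebyshev (cartan_entry (enat k)) k = 0"
  using chebyshev_sin[of "pi / real k" k] sin_pi_over_pos[OF assms] assms
  by (simp add: cartan_entry_def)

lemma chebyshev_cartan_nonneg:
  assumes "2 \<le> k" "enat n \<le> k"
  shows "0 \<le> chebyshev (cartan_entry k) n"
proof (cases k)
  case (enat k')
  then have k': "2 \<le> k'" "n \<le> k'"
    using assms by (simp_all add: numeral_eq_enat)
  have "0 \<le> sin (real n * (pi / real k'))"
  proof (rule sin_ge_zero)
    show "real n * (pi / real k') \<le> pi"
      using k' by (simp add: divide_le_eq)
  qed simp
  then show ?thesis
    using chebyshev_sin[of "pi / real k'" n] sin_pi_over_pos[OF k'(1)] enat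
    by (metis cartan_entry_def enat.simps(4) mult_neg_pos not_less)
next
  case infinity
  then show ?thesis by (simp add: cartan_entry_def chebyshev_minus_two)
qed

section \<open>The geometric representation\<close>

lemma (in group) list_product_closed:
  "set xs \<subseteq> carrier G \<Longrightarrow> list_product G xs \<in> carrier G"
  by (induction xs) (simp_all add: list_product_def)

lemma (in group) list_product_Cons: "list_product G (x # xs) = x \<otimes> list_product G xs"
  by (simp add: list_product_def)

lemma (in group) list_product_append:
  assumes "set xs \<subseteq> carrier G" "set ys \<subseteq> carrier G"
  shows "list_product G (xs @ ys) = list_product G xs \<otimes> list_product G ys"
  using assms
proof (induction xs)
  case Nil
  then show ?case using list_product_closed[of ys] by (simp add: list_product_def)
next
  case (Cons x xs)
  then show ?case
    using list_product_closed[of xs] list_product_closed[of ys]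
    by (simp add: list_product_Cons m_assoc)
qed

text \<open>The generators are indexed by a finite type so that vectors and matrices over them are available.\<close>
locale indexed_coxeter_system = group W for W :: "('a, 'b) monoid_scheme" (structure) +
  fixes g :: "'n::finite \<Rightarrow> 'a" and m :: "'a \<Rightarrow> 'a \<Rightarrow> enat"
  assumes inj_g: "inj g"
    and coxeter_matrix: "coxeter_matrix (range g) m"
    and presentation: "has_presentation W (range g) (coxeter_relators (range g) m)"
begin

abbreviation label :: "'n \<Rightarrow> 'n \<Rightarrow> enat" where "label i j \<equiv> m (g i) (g j)"

lemma label_diag: "label i i = 1"
  and label_sym: "label i j = label j i"
  and label_ge_2: "i \<noteq> j \<Longrightarrow> 2 \<le> label i j"
  using coxeter_matrix inj_g by (auto simp: coxeter_matrix_def inj_eq)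

lemma g_closed [simp]: "g i \<in> carrier W"
  using presentation by (auto simp: has_presentation_def)

text \<open>Generators are involutions, so words without formal inverses suffice.\<close>
definition word_prod :: "'n list \<Rightarrow> 'a" where
  "word_prod is = list_product W (map g is)"

lemma word_prod_closed [simp]: "word_prod is \<in> carrier W"
  unfolding word_prod_def by (rule list_product_closed) auto

lemma word_prod_Nil [simp]: "word_prod [] = \<one>"
  by (simp add: word_prod_def list_product_def)

lemma word_prod_Cons: "word_prod (i # is) = g i \<otimes> word_prod is"
  by (simp add: word_prod_def list_product_Cons)

lemma word_prod_append: "word_prod (is @ js) = word_prod is \<otimes> word_prod js"
  unfolding word_prod_def map_append by (rule list_product_append) auto

lemma relation:
  assumes "label i j = enat k"
  shows "word_prod (concat (replicate k [i, j])) = \<one>"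
proof -
  let ?w = "concat (replicate k [(g i, True), (g j, True)])"
  have "?w \<in> coxeter_relators (range g) m"
    using assms unfolding coxeter_relators_def by blast
  then have "word_move (range g) (coxeter_relators (range g) m) ?w []"
    using word_move.relator[of ?w _ _ "[]" "[]"] by simp
  then have "equivclp (word_move (range g) (coxeter_relators (range g) m)) ?w []"
    by (rule r_into_equivclp)
  moreover have "?w \<in> lists (range g \<times> UNIV)"
    by (induction k) auto
  ultimately have "word_value W ?w = \<one>"
    using presentation unfolding has_presentation_def by blast
  moreover have "map (\<lambda>(s, e). if e then s else inv s) ?w = map g (concat (replicate k [i, j]))"
    by (induction k) simp_all
  ultimately show ?thesis
    by (simp add: word_value_def word_prod_def)
qed

lemma g_sq [simp]: "g i \<otimes> g i = \<one>"
  using relation[of i i 1] by (simp add: label_diag one_enat_def word_prod_Cons)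

lemma inv_g [simp]: "inv (g i) = g i"
  by (simp add: inv_equality)

lemma word_prod_rev_left: "word_prod (rev is) \<otimes> word_prod is = \<one>"
proof (induction "is")
  case (Cons i "is")
  have "word_prod (rev (i # is)) \<otimes> word_prod (i # is) =
    word_prod (rev is) \<otimes> ((g i \<otimes> g i) \<otimes> word_prod is)"
    unfolding rev.simps word_prod_append word_prod_Cons
    by (simp add: m_assoc del: g_sq)
  also have "\<dots> = \<one>" using Cons.IH by simp
  finally show ?case .
qed simp

lemma inv_word_prod: "inv (word_prod is) = word_prod (rev is)"
  using word_prod_rev_left by (intro inv_equality) simp_all

lemma word_prod_surj:
  assumes "x \<in> carrier W"
  shows "\<exists>is. word_prod is = x"
proof -
  have "x \<in> generate W (range g)"
    using assms presentation by (simp add: has_presentation_def)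
  then show ?thesis
  proof (induction rule: generate.induct)
    case one
    then show ?case using word_prod_Nil by blast
  next
    case (incl h)
    then obtain i where "h = g i" by blast
    then have "word_prod [i] = h" by (simp add: word_prod_Cons)
    then show ?case by blast
  next
    case (inv h)
    then obtain i where "h = g i" by blast
    then have "word_prod [i] = inv h" by (simp add: word_prod_Cons)
    then show ?case by blast
  next
    case (eng h1 h2)
    then show ?case using word_prod_append by metis
  qed
qed

text \<open>This is twice the usual bilinear form of the Coxeter system.\<close>
definition cartan :: "real^'n^'n" where
  "cartan = (\<chi> i j. cartan_entry (label i j))"

lemma cartan_sym: "transpose cartan = cartan"
  by (simp add: cartan_def transpose_def vec_eq_iff) (metis label_sym)

lemma cartan_diag: "cartan $ i $ i = 2"
  by (simp add: cartan_def label_diag cartan_entry_one)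

lemma cartan_commute: "cartan $ i $ j = cartan $ j $ i"
  by (simp add: cartan_def) (metis label_sym)

abbreviation circle_cartan (infixl "\<odot>" 70) where
  "M \<odot> N \<equiv> circle cartan M N"

definition gen_rep :: "'n \<Rightarrow> real^'n^'n" where
  "gen_rep i = rank_one (axis i 1) (axis i 1)"

primrec word_rep :: "'n list \<Rightarrow> real^'n^'n" where
  "word_rep [] = 0"
| "word_rep (i # is) = gen_rep i \<odot> word_rep is"

lemma word_rep_append: "word_rep (is @ js) = word_rep is \<odot> word_rep js"
  by (induction "is") (simp_all add: circle_assoc)

lemma gen_rep_circle_nth:
  "(gen_rep i \<odot> N) $ a $ b =
     N $ a $ b + (if a = i then (if b = i then 1 else 0) - (cartan ** N) $ i $ b else 0)"
proof -
  have "gen_rep i ** cartan ** N = rank_one (axis i 1) (axis i 1 v* (cartan ** N))"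
    by (simp add: gen_rep_def rank_one_mult_right vector_matrix_mul_assoc)
  moreover have "(axis i 1 v* (cartan ** N)) $ b = (cartan ** N) $ i $ b"
    by (simp add: vector_matrix_mult_def axis_def if_distrib[of "\<lambda>x. x * _"] cong: if_cong)
  ultimately show ?thesis
    by (simp add: circle_def rank_one_def gen_rep_def axis_def)
qed

lemma gen_rep_sq: "gen_rep i \<odot> gen_rep i = 0"
proof -
  have "(cartan ** gen_rep i) $ i $ b = (if b = i then 2 else 0)" for b
    by (simp add: gen_rep_def rank_one_def matrix_matrix_mult_def axis_def cartan_diag
        if_distrib[of "\<lambda>x. _ * x"] if_distrib[of "\<lambda>x. x * _"] cong: if_cong)
  then show ?thesis
    by (simp add: vec_eq_iff gen_rep_circle_nth) (simp add: gen_rep_def rank_one_def axis_def)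
qed

definition pair_block :: "'n \<Rightarrow> 'n \<Rightarrow> real \<Rightarrow> real \<Rightarrow> real \<Rightarrow> real \<Rightarrow> real^'n^'n" where
  "pair_block i j p q r s = (\<chi> a b.
     if a = i then (if b = i then p else if b = j then q else 0)
     else if a = j then (if b = i then r else if b = j then s else 0) else 0)"

lemma cartan_pair_block:
  assumes "i \<noteq> j"
  shows "(cartan ** pair_block i j p q r s) $ x $ b =
    cartan $ x $ i * (if b = i then p else if b = j then q else 0) +
    cartan $ x $ j * (if b = i then r else if b = j then s else 0)"
proof -
  let ?K = "pair_block i j p q r s"
  have "(\<Sum>k\<in>UNIV. cartan $ x $ k * ?K $ k $ b) = (\<Sum>k\<in>{i, j}. cartan $ x $ k * ?K $ k $ b)"
    by (rule sum.mono_neutral_right) (auto simp: pair_block_def)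
  then show ?thesis
    using assms by (simp add: matrix_matrix_mult_def pair_block_def)
qed

lemma gen_rep_pair_block:
  assumes "i \<noteq> j"
  defines "a \<equiv> cartan $ i $ j"
  shows "gen_rep i \<odot> pair_block i j p q r s = pair_block i j (1 - a * r - p) (- a * s - q) r s"
    and "gen_rep j \<odot> pair_block i j p q r s = pair_block i j p q (- a * p - r) (1 - a * q - s)"
  using assms
  by (simp_all add: vec_eq_iff gen_rep_circle_nth cartan_pair_block cartan_diag
      cartan_commute[of j i] del: vec_lambda_beta)
     (auto simp: pair_block_def)

text \<open>A closed form for the powers of \<open>s\<^sub>i s\<^sub>j\<close>. The entry at \<open>(j, i)\<close> is \<open>c\<^sub>k c\<^sub>k\<^sub>-\<^sub>1\<close>, written by
  means of the recurrence so that it also makes sense for \<open>k = 0\<close>. Every entry has the factor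
  \<open>c\<^sub>k\<close>, which vanishes when \<open>k\<close> is the order of \<open>s\<^sub>i s\<^sub>j\<close>.\<close>
lemma word_rep_dihedral:
  assumes "i \<noteq> j"
  defines "a \<equiv> cartan $ i $ j"
  defines "c \<equiv> chebyshev a"
  shows "word_rep (concat (replicate k [i, j])) =
    pair_block i j ((c k)\<^sup>2) (c k * c (Suc k)) (c k * (- a * c k - c (Suc k))) ((c k)\<^sup>2)"
proof (induction k)
  case 0
  then show ?case by (simp add: c_def pair_block_def vec_eq_iff)
next
  case (Suc k)
  have inv: "(c (Suc n))\<^sup>2 = 1 - a * c n * c (Suc n) - (c n)\<^sup>2" for n
    using chebyshev_invariant[of a n] by (simp add: c_def)
  have rec: "c (Suc (Suc n)) = - a * c (Suc n) - c n" for n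
    by (simp add: c_def)
  have "word_rep (concat (replicate (Suc k) [i, j])) = gen_rep i \<odot> (gen_rep j \<odot>
    pair_block i j ((c k)\<^sup>2) (c k * c (Suc k)) (c k * (- a * c k - c (Suc k))) ((c k)\<^sup>2))"
    using Suc by simp
  also have "gen_rep j \<odot>
      pair_block i j ((c k)\<^sup>2) (c k * c (Suc k)) (c k * (- a * c k - c (Suc k))) ((c k)\<^sup>2)
    = pair_block i j ((c k)\<^sup>2) (c k * c (Suc k)) (c k * c (Suc k)) ((c (Suc k))\<^sup>2)"
    unfolding gen_rep_pair_block[OF assms(1)] inv
    by (simp add: a_def power2_eq_square algebra_simps)
  also have "gen_rep i \<odot> \<dots> = pair_block i j ((c (Suc k))\<^sup>2) (c (Suc k) * c (Suc (Suc k)))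
      (c (Suc k) * (- a * c (Suc k) - c (Suc (Suc k)))) ((c (Suc k))\<^sup>2)"
  proof -
    have e: "1 - a * (c k * c (Suc k)) - (c k)\<^sup>2 = (c (Suc k))\<^sup>2"
      "- a * (c (Suc k))\<^sup>2 - c k * c (Suc k) = c (Suc k) * c (Suc (Suc k))"
      "c k * c (Suc k) = c (Suc k) * (- a * c (Suc k) - c (Suc (Suc k)))"
      unfolding rec by (simp add: inv[of k] mult.assoc, simp_all add: power2_eq_square algebra_simps)
    show ?thesis
      unfolding gen_rep_pair_block(1)[OF assms(1), folded a_def] e(1,2) by (simp only: e(3))
  qed
  finally show ?case .
qed

lemma word_rep_relation:
  assumes "label i j = enat k"
  shows "word_rep (concat (replicate k [i, j])) = 0"
proof (cases "i = j")
  case True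
  then have "k = 1" using assms by (simp add: label_diag one_enat_def)
  then show ?thesis using True by (simp add: gen_rep_sq)
next
  case False
  have "2 \<le> k"
    using label_ge_2[OF False] assms by (simp add: numeral_eq_enat)
  then have "chebyshev (cartan $ i $ j) k = 0"
    using chebyshev_cartan_zero assms by (simp add: cartan_def)
  then show ?thesis
    unfolding word_rep_dihedral[OF False] by (simp add: pair_block_def vec_eq_iff)
qed

definition letters_rep :: "'a word \<Rightarrow> real^'n^'n" where
  "letters_rep w = word_rep (map (\<lambda>p. the_inv g (fst p)) w)"

lemma letters_rep_move:
  assumes "word_move (range g) (coxeter_relators (range g) m) u v"
  shows "letters_rep u = letters_rep v"
  using assms
proof cases
  case (cancel s u' e v')
  have "gen_rep i \<odot> (gen_rep i \<odot> M) = M" for i M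
    by (simp add: gen_rep_sq flip: circle_assoc)
  then show ?thesis
    unfolding cancel letters_rep_def by (simp add: word_rep_append)
next
  case (relator r u' v')
  then obtain i j k where r: "r = concat (replicate k [(g i, True), (g j, True)])"
    and k: "label i j = enat k"
    unfolding coxeter_relators_def by blast
  have "map (\<lambda>p. the_inv g (fst p)) r = concat (replicate k [i, j])"
    unfolding r by (induction k) (simp_all add: the_inv_f_f[OF inj_g])
  then show ?thesis
    unfolding relator letters_rep_def by (simp add: word_rep_append word_rep_relation[OF k])
qed

text \<open>This is where the presentation is used in full: a word with trivial value is connected to
  the empty word by moves, and no move changes the matrix.\<close>
lemma word_rep_of_one:
  assumes "word_prod is = \<one>"
  shows "word_rep is = 0"
proof -
  let ?w = "map (\<lambda>i. (g i, True)) is"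
  have "word_value W ?w = \<one>"
    using assms by (simp add: word_value_def word_prod_def comp_def)
  moreover have "?w \<in> lists (range g \<times> UNIV)" by auto
  ultimately have "equivclp (word_move (range g) (coxeter_relators (range g) m)) ?w []"
    using presentation unfolding has_presentation_def by blast
  then have "letters_rep ?w = letters_rep []"
    by (induction rule: equivclp_induct) (auto dest: letters_rep_move)
  then show ?thesis
    by (simp add: letters_rep_def comp_def the_inv_f_f[OF inj_g])
qed

lemma word_rep_cong:
  assumes "word_prod is = word_prod js"
  shows "word_rep is = word_rep js"
proof -
  have "word_prod (is @ rev js) = \<one>" "word_prod (rev js @ js) = \<one>"
    using word_prod_rev_left[of js] word_prod_rev_left[of "rev js"] assms
    by (simp_all add: word_prod_append)
  then have *: "word_rep (is @ rev js) = 0" "word_rep (rev js @ js) = 0"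
    by (simp_all add: word_rep_of_one)
  have "word_rep is = word_rep is \<odot> word_rep (rev js @ js)"
    by (simp add: *)
  also have "\<dots> = word_rep (is @ rev js) \<odot> word_rep js"
    by (simp add: word_rep_append circle_assoc)
  finally show ?thesis by (simp add: *)
qed

end

section \<open>Faithfulness\<close>

primrec alternating :: "'n \<Rightarrow> 'n \<Rightarrow> nat \<Rightarrow> 'n list" where
  "alternating i j 0 = []"
| "alternating i j (Suc k) = alternating j i k @ [j]"

lemma length_alternating [simp]: "length (alternating i j k) = k"
  by (induction k arbitrary: i j) auto

text \<open>The recursion of \<^const>\<open>alternating\<close> fixes the last letter; the first letter depends on the
  parity of the length.\<close>
lemma alternating_Cons:
  "alternating i j (Suc k) = (if even k then j else i) # alternating i j k"
proof (induction k arbitrary: i j)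
  case (Suc k)
  have "alternating i j (Suc (Suc k)) = alternating j i (Suc k) @ [j]"
    by simp
  also have "\<dots> = (if even k then i else j) # alternating i j (Suc k)"
    by (simp only: Suc[of j i]) simp
  finally show ?case by (simp del: alternating.simps)
qed simp

lemma alternating_suffix:
  assumes "n \<le> k"
  shows "\<exists>xs. alternating i j k = xs @ alternating i j n \<and> length xs = k - n"
  using assms
proof (induction k)
  case (Suc k)
  show ?case
  proof (cases "n = Suc k")
    case False
    then obtain xs where "alternating i j k = xs @ alternating i j n" "length xs = k - n"
      using Suc by auto
    then have "alternating i j (Suc k) = ((if even k then j else i) # xs) @ alternating i j n"
      "length ((if even k then j else i) # xs) = Suc k - n"
      using Suc.prems False unfolding alternating_Cons by auto
    then show ?thesis by blast
  qed simp
qed simp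

context indexed_coxeter_system
begin

lemma word_prod_rev_alternating:
  "word_prod (rev (alternating j i k) @ alternating i j k) = word_prod (concat (replicate k [i, j]))"
proof (induction k arbitrary: i j)
  case (Suc k)
  have shift: "concat (replicate k [j, i]) @ [j] = j # concat (replicate k [i, j])" for i j :: 'n and k
    by (induction k) simp_all
  have "word_prod (rev (alternating j i (Suc k)) @ alternating i j (Suc k))
      = g i \<otimes> (word_prod (rev (alternating i j k) @ alternating j i k) \<otimes> word_prod [j])"
    by (simp add: word_prod_append word_prod_Cons m_assoc)
  also have "\<dots> = g i \<otimes> word_prod (concat (replicate k [j, i]) @ [j])"
    unfolding Suc by (simp add: word_prod_append)
  also have "\<dots> = word_prod (concat (replicate (Suc k) [i, j]))"
    unfolding shift by (simp add: word_prod_Cons)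
  finally show ?case .
qed simp

lemma braid_relation:
  assumes "label i j = enat k"
  shows "word_prod (alternating i j k) = word_prod (alternating j i k)"
proof -
  have "inv (word_prod (alternating j i k)) \<otimes> word_prod (alternating i j k) = \<one>"
    using word_prod_rev_alternating[of j i k] relation[OF assms]
    by (simp add: word_prod_append inv_word_prod)
  then show ?thesis
    by (metis inv_equality inv_inv inv_closed word_prod_closed)
qed

text \<open>The image of the simple root \<open>\<alpha>\<^sub>i\<close> under the element represented by a word.\<close>
definition root_image :: "'n list \<Rightarrow> 'n \<Rightarrow> real^'n" where
  "root_image is i = action_matrix cartan (word_rep is) *v axis i 1"

lemma action_matrix_append:
  "action_matrix cartan (word_rep (is @ js)) =
    action_matrix cartan (word_rep is) ** action_matrix cartan (word_rep js)"
  by (simp add: word_rep_append action_matrix_circle)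

lemma action_gen:
  "action_matrix cartan (gen_rep i) *v v = v - (cartan $ i \<bullet> v) *\<^sub>R axis i 1"
proof -
  have "axis i 1 v* cartan = cartan $ i"
    by (simp add: vec_eq_iff vector_matrix_mult_def axis_def if_distrib[of "\<lambda>x. x * _"] cong: if_cong)
  then have "gen_rep i ** cartan = rank_one (axis i 1) (cartan $ i)"
    by (simp add: gen_rep_def rank_one_mult_right)
  then show ?thesis
    by (simp add: action_matrix_def matrix_vector_mult_diff_rdistrib rank_one_vector)
qed

lemma cartan_inner_axis: "cartan $ i \<bullet> axis j 1 = cartan $ i $ j"
  by (simp add: inner_axis)

lemma root_image_Nil: "root_image [] i = axis i 1"
  by (simp add: root_image_def action_matrix_def matrix_zero_mult)

lemma root_image_append:
  "root_image (is @ js) i = action_matrix cartan (word_rep is) *v root_image js i"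
  by (simp add: root_image_def action_matrix_append matrix_vector_mul_assoc)

lemma root_image_Cons:
  "root_image (j # is) i = action_matrix cartan (gen_rep j) *v root_image is i"
  using root_image_append[of "[j]" "is"] by simp

lemma root_image_snoc_self: "root_image (is @ [i]) i = - root_image is i"
proof -
  have "root_image [i] i = - axis i 1"
    by (simp add: root_image_Cons root_image_Nil action_gen cartan_inner_axis cartan_diag scaleR_2)
  then show ?thesis
    unfolding root_image_append by (simp add: root_image_def vec.neg)
qed

lemma root_image_cong:
  "word_prod is = word_prod js \<Longrightarrow> root_image is i = root_image js i"
  unfolding root_image_def using word_rep_cong by metis

lemma root_image_alternating:
  assumes "i \<noteq> j"
  defines "c \<equiv> chebyshev (cartan $ i $ j)"
  shows "root_image (alternating i j k) i =
    (if even k then c (Suc k) *\<^sub>R axis i 1 + c k *\<^sub>R axis j 1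
     else c k *\<^sub>R axis i 1 + c (Suc k) *\<^sub>R axis j 1)"
proof (induction k)
  case 0
  then show ?case by (simp add: root_image_Nil c_def)
next
  case (Suc k)
  have rec: "c (Suc (Suc k)) = - cartan $ i $ j * c (Suc k) - c k"
    by (simp add: c_def)
  show ?case
    unfolding alternating_Cons root_image_Cons Suc action_gen
    by (simp add: inner_add_right cartan_inner_axis cartan_diag cartan_commute[of j i] rec)
       (simp add: algebra_simps flip: scaleR_add_left)
qed

definition reduced :: "'n list \<Rightarrow> bool" where
  "reduced is \<longleftrightarrow> (\<forall>js. word_prod js = word_prod is \<longrightarrow> length is \<le> length js)"

lemma exists_reduced: "\<exists>js. word_prod js = word_prod is \<and> reduced js"
proof -
  have "\<exists>js. word_prod js = word_prod is \<and>
      (\<forall>ks. word_prod ks = word_prod is \<longrightarrow> length js \<le> length ks)"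
    by (rule ex_has_least_nat) simp
  then show ?thesis unfolding reduced_def by metis
qed

text \<open>Tits' theorem: if appending the letter \<open>i\<close> to a reduced word does not give a shorter element, then
  the image of \<open>\<alpha>\<^sub>i\<close> is a nonnegative combination of simple roots. Let \<open>j\<close> be the last letter and
  split off an alternating suffix in \<open>i\<close>, \<open>j\<close> that is as long as possible among all reduced words
  for the same element. The remaining word \<open>v\<close> is shorter, and can be shortened neither by \<open>i\<close> nor
  by \<open>j\<close>, so by induction it maps \<open>\<alpha>\<^sub>i\<close> and \<open>\<alpha>\<^sub>j\<close> to nonnegative vectors. The suffix is shorter than
  the order of \<open>s\<^sub>i s\<^sub>j\<close>, for otherwise a braid relation would make it end in \<open>i\<close>; hence it maps
  \<open>\<alpha>\<^sub>i\<close> to a nonnegative combination of \<open>\<alpha>\<^sub>i\<close> and \<open>\<alpha>\<^sub>j\<close>.\<close>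
theorem root_image_nonneg:
  assumes "reduced is"
    and "\<And>js. word_prod js = word_prod (is @ [i]) \<Longrightarrow> length is \<le> length js"
  shows "0 \<le> root_image is i $ a"
  using assms
proof (induction "length is" arbitrary: "is" i a rule: less_induct)
  case less
  show ?case
  proof (cases "is" rule: rev_cases)
    case Nil
    then show ?thesis by (simp add: root_image_Nil axis_def)
  next
    case (snoc is' j)
    have "word_prod (is' @ [j, j]) = word_prod is'"
      by (simp add: word_prod_append word_prod_Cons)
    then have "i \<noteq> j"
      using less.prems(2)[of is'] snoc by auto
    define P where "P k \<longleftrightarrow>
      (\<exists>v. word_prod (v @ alternating i j k) = word_prod is \<and> length v + k = length is)" for k
    have "P 1"
      unfolding P_def using snoc by (intro exI[of _ is']) simp
    define k where "k = (GREATEST k. P k)"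
    have bound: "k \<le> length is" if "P k" for k
      using that by (auto simp: P_def)
    have "P k" and k_max: "\<And>k'. P k' \<Longrightarrow> k' \<le> k"
      using GreatestI_nat[of P 1 "length is"] Greatest_le_nat[of P _ "length is"] \<open>P 1\<close> bound
      unfolding k_def by blast+
    then obtain v where v: "word_prod (v @ alternating i j k) = word_prod is"
      "length v + k = length is"
      unfolding P_def by blast
    have "1 \<le> k" using k_max \<open>P 1\<close> by blast
    then obtain l where l: "k = Suc l" by (cases k) auto
    have "reduced v"
      unfolding reduced_def
    proof (intro allI impI)
      fix js assume "word_prod js = word_prod v"
      then have "word_prod (js @ alternating i j k) = word_prod is"
        using v(1) by (simp add: word_prod_append)
      then have "length is \<le> length (js @ alternating i j k)"
        using less.prems(1) unfolding reduced_def by blast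
      then show "length v \<le> length js" using v(2) by simp
    qed
    have cancel: "word_prod (v @ [x]) \<otimes> word_prod (x # ys) = word_prod (v @ ys)" for x ys
      using word_prod_append[of "v @ [x]" "x # ys"]
      by (simp add: word_prod_append word_prod_Cons m_assoc)
         (simp flip: m_assoc)
    have no_descent: "length v \<le> length js"
      if x: "x \<in> {i, j}" and js: "word_prod js = word_prod (v @ [x])" for x js
    proof (rule ccontr)
      assume short: "\<not> length v \<le> length js"
      \<comment> \<open>\<open>y\<close> is the letter that prolongs the alternating suffix, \<open>z\<close> is its first letter.\<close>
      define y where "y = (if even k then j else i)"
      define z where "z = (if even l then j else i)"
      have "x = y \<or> x = z"
        using x l by (auto simp: y_def z_def)
      then show False
      proof
        \<comment> \<open>a descent at \<open>y\<close> would give a longer alternating suffix\<close>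
        assume "x = y"
        then have "alternating i j (Suc k) = x # alternating i j k"
          unfolding alternating_Cons y_def by simp
        then have *: "word_prod (js @ alternating i j (Suc k)) = word_prod is"
          using cancel[of x "alternating i j k"] js v(1)
          by (simp del: alternating.simps add: word_prod_append[of js])
        then have "length is \<le> length (js @ alternating i j (Suc k))"
          using less.prems(1) unfolding reduced_def by blast
        then have "length js + Suc k = length is"
          using short v(2) by simp
        then have "P (Suc k)" using * unfolding P_def by blast
        then show False using k_max by fastforce
      next
        \<comment> \<open>a descent at \<open>z\<close> would give a shorter word for the same element\<close>
        assume "x = z"
        then have "alternating i j k = x # alternating i j l"
          unfolding l alternating_Cons z_def by simp
        then have "word_prod (js @ alternating i j l) = word_prod is"
          using js v(1) by (simp add: word_prod_append word_prod_Cons m_assoc)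
        then have "length is \<le> length (js @ alternating i j l)"
          using less.prems(1) unfolding reduced_def by blast
        then show False using short v(2) l by simp
      qed
    qed
    have "length v < length is" using v(2) \<open>1 \<le> k\<close> by simp
    then have nonneg: "0 \<le> root_image v x $ a" if "x \<in> {i, j}" for x
      using less.hyps[of v x a] \<open>reduced v\<close> no_descent[OF that] by blast
    \<comment> \<open>The braid relation would turn the end of the suffix into a word that ends in \<open>i\<close>.\<close>
    have "enat (Suc k) \<le> label i j"
    proof (rule ccontr)
      assume "\<not> enat (Suc k) \<le> label i j"
      then obtain n where n: "label i j = enat n" "n \<le> k"
        by (cases "label i j") auto
      have "2 \<le> n"
        using label_ge_2[OF \<open>i \<noteq> j\<close>] n(1) by (simp add: numeral_eq_enat)
      then obtain n' where n': "n = Suc n'"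
        by (metis Suc_le_D numeral_2_eq_2)
      obtain xs where xs: "alternating i j k = xs @ alternating i j n" "length xs = k - n"
        using alternating_suffix[OF n(2), of i j] by (elim exE conjE)
      have "word_prod (is @ [i]) = word_prod (v @ xs @ alternating i j n @ [i])"
        unfolding word_prod_append[of "is"] v(1)[symmetric] xs(1)
        by (simp add: word_prod_append m_assoc)
      also have "\<dots> = word_prod (v @ xs @ alternating j i n @ [i])"
        using braid_relation[OF n(1)] by (simp only: word_prod_append)
      also have "\<dots> = word_prod (v @ xs @ alternating i j n')"
        unfolding n' by (simp add: word_prod_append word_prod_Cons m_assoc)
      finally have "length is \<le> length (v @ xs @ alternating i j n')"
        by (rule less.prems(2)[OF sym])
      then show False using v(2) xs(2) n(2) n' by simp
    qed
    define c where "c = chebyshev (cartan $ i $ j)"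
    have "enat k \<le> label i j"
      using \<open>enat (Suc k) \<le> label i j\<close> order_trans[of "enat k" "enat (Suc k)"] by simp
    then have c: "0 \<le> c k" "0 \<le> c (Suc k)"
      using chebyshev_cartan_nonneg[OF label_ge_2[OF \<open>i \<noteq> j\<close>]] \<open>enat (Suc k) \<le> label i j\<close>
      by (simp_all add: c_def cartan_def)
    have "root_image is i =
        action_matrix cartan (word_rep v) *v root_image (alternating i j k) i"
      using root_image_cong[OF v(1)] root_image_append by simp
    also have "\<dots> = (if even k then c (Suc k) *\<^sub>R root_image v i + c k *\<^sub>R root_image v j
        else c k *\<^sub>R root_image v i + c (Suc k) *\<^sub>R root_image v j)"
      unfolding root_image_alternating[OF \<open>i \<noteq> j\<close>, folded c_def]
      by (simp add: root_image_def algebra_simps)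
    finally show ?thesis
      using nonneg c by simp
  qed
qed

text \<open>If \<open>i\<close> is the last letter of a reduced word, then the word without it maps \<open>\<alpha>\<^sub>i\<close> to a nonnegative
  vector, so the word itself maps \<open>\<alpha>\<^sub>i\<close> to a nonpositive one and cannot act trivially.\<close>
theorem word_rep_faithful:
  assumes "word_rep is = 0"
  shows "word_prod is = \<one>"
proof -
  obtain js where js: "word_prod js = word_prod is" "reduced js"
    using exists_reduced by blast
  have "js = []"
  proof (cases js rule: rev_cases)
    case (snoc ks i)
    have "length ks \<le> length ls" if "word_prod ls = word_prod ks" for ls
    proof -
      have "word_prod (ls @ [i]) = word_prod js"
        using that snoc by (simp add: word_prod_append)
      then have "length js \<le> length (ls @ [i])"
        using js(2) unfolding reduced_def by blast
      then show ?thesis using snoc by simp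
    qed
    moreover have "length ks \<le> length ls" if "word_prod ls = word_prod (ks @ [i])" for ls
      using that js(2) snoc unfolding reduced_def by fastforce
    ultimately have "0 \<le> root_image ks i $ i"
      by (intro root_image_nonneg) (auto simp: reduced_def)
    moreover have "root_image ks i = - root_image js i"
      using root_image_snoc_self snoc by simp
    moreover have "root_image js i = axis i 1"
      using assms word_rep_cong[OF js(1)]
      by (simp add: root_image_def action_matrix_def matrix_zero_mult)
    ultimately show ?thesis by simp
  qed
  then show ?thesis using js(1) by simp
qed

end

section \<open>Reflections and Coxeter elements\<close>

context indexed_coxeter_system
begin

definition rep :: "'a \<Rightarrow> real^'n^'n" where
  "rep x = word_rep (SOME is. word_prod is = x)"

lemma rep_word_prod: "rep (word_prod is) = word_rep is"
  unfolding rep_def by (rule word_rep_cong) (rule someI_ex, blast)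

lemma rep_one: "rep \<one> = 0"
  using rep_word_prod[of "[]"] by simp

lemma rep_mult:
  assumes "x \<in> carrier W" "y \<in> carrier W"
  shows "rep (x \<otimes> y) = rep x \<odot> rep y"
  using word_prod_surj[OF assms(1)] word_prod_surj[OF assms(2)]
  by (metis rep_word_prod word_prod_append word_rep_append)

lemma rep_g: "rep (g i) = gen_rep i"
  using rep_word_prod[of "[i]"] by (simp add: word_prod_Cons)

lemma rep_inj:
  assumes "x \<in> carrier W" "y \<in> carrier W" "rep x = rep y"
  shows "x = y"
proof -
  have "rep (x \<otimes> inv y) = 0"
    using assms rep_mult[of x "inv y"] rep_mult[of y "inv y"] by (simp add: rep_one)
  moreover obtain "is" where "word_prod is = x \<otimes> inv y"
    using assms word_prod_surj[of "x \<otimes> inv y"] by auto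
  ultimately have "x \<otimes> inv y = \<one>"
    using word_rep_faithful rep_word_prod by metis
  then show ?thesis
    using assms by (metis inv_closed inv_equality inv_inv)
qed

lemma word_rep_rev: "word_rep (rev is) = transpose (word_rep is)"
  by (induction "is")
    (simp_all add: word_rep_append transpose_circle[OF cartan_sym] gen_rep_def transpose_rank_one,
     simp add: transpose_def vec_eq_iff)

lemma rep_inv:
  assumes "x \<in> carrier W"
  shows "rep (inv x) = transpose (rep x)"
  using word_prod_surj[OF assms] by (metis inv_word_prod rep_word_prod word_rep_rev)

abbreviation T :: "'a set" where "T \<equiv> reflections W (range g)"

lemma reflection_closed: "t \<in> T \<Longrightarrow> t \<in> carrier W"
  unfolding reflections_def by auto

lemma generator_reflection: "g i \<in> T"
proof -
  have "g i = \<one> \<otimes> g i \<otimes> inv \<one>" by simp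
  then show ?thesis unfolding reflections_def by blast
qed

lemma reflection_root:
  assumes "t \<in> T"
  obtains b where "b \<noteq> 0" "rep t = rank_one b b"
proof -
  obtain w i where w: "w \<in> carrier W" "t = w \<otimes> g i \<otimes> inv w"
    using assms unfolding reflections_def by blast
  define b where "b = action_matrix cartan (rep w) *v axis i 1"
  have "rep w \<odot> rep (inv w) = 0"
    using w(1) rep_mult[of w "inv w"] rep_one by simp
  then have b: "rep t = rank_one b b"
    unfolding w(2) b_def using w(1)
    by (simp add: rep_mult rep_g gen_rep_def circle_conjugate[OF cartan_sym] rep_inv)
  have "b \<noteq> 0"
  proof
    assume "b = 0"
    then have "t = \<one>"
      using b assms reflection_closed rep_inj rep_one by simp
    moreover have "g i = inv w \<otimes> t \<otimes> w"
      unfolding w(2) using w(1) by (simp add: m_assoc) (simp flip: m_assoc)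
    ultimately have "g i = \<one>"
      using w(1) by simp
    then have "gen_rep i $ i $ i = 0"
      using rep_g rep_one by (metis zero_index)
    then show False by (simp add: gen_rep_def rank_one_def)
  qed
  then show ?thesis using that b by blast
qed

lemma reflection_sq:
  assumes "t \<in> T"
  shows "t \<otimes> t = \<one>"
proof -
  obtain w i where w: "w \<in> carrier W" "t = w \<otimes> g i \<otimes> inv w"
    using assms unfolding reflections_def by blast
  have "inv w \<otimes> (w \<otimes> y) = y" "g i \<otimes> (g i \<otimes> y) = y" if "y \<in> carrier W" for y
    using w(1) that by (simp_all flip: m_assoc)
  then show ?thesis
    unfolding w(2) using w(1) by (simp add: m_assoc)
qed

text \<open>By faithfulness a reflection is determined by the line of its root.\<close>
lemma reflection_eqI:
  assumes "t \<in> T" "t' \<in> T" "rep t = rank_one b b" "rep t' = rank_one b' b'"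
    and "b = k *\<^sub>R b'" "k \<noteq> 0"
  shows "t = t'"
proof (rule rep_inj)
  have sq: "rep s \<odot> rep s = 0" if "s \<in> T" for s
    using that reflection_sq rep_mult[of s s] rep_one reflection_closed by simp
  have "rep t = k\<^sup>2 *\<^sub>R rep t'"
    unfolding assms(3-5) by (rule rank_one_scaleR)
  then show "rep t = rep t'"
    by (rule circle_involution_proportional[OF sq[OF assms(1)] sq[OF assms(2)]]) (use assms(6) in simp)
qed (use assms(1,2) reflection_closed in auto)

lemma word_rep_column:
  assumes "b \<notin> set is"
  shows "word_rep is $ a $ b = 0"
  using assms
  by (induction "is" arbitrary: a) (simp_all add: gen_rep_circle_nth matrix_matrix_mult_def)

text \<open>The matrix of a word without repeated letters is unitriangular on these letters: a letter that
  occurs only at the front leaves a unit vector in its own column.\<close>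
lemma coxeter_word_nonsingular:
  assumes "distinct is" "f v* word_rep is = 0" "i \<in> set is"
  shows "f $ i = 0"
  using assms
proof (induction "is")
  case (Cons x xs)
  have "word_rep (x # xs) $ a $ x = (if a = x then 1 else 0)" for a
    using Cons.prems(1)
    by (simp add: gen_rep_circle_nth word_rep_column matrix_matrix_mult_def)
  then have "(f v* word_rep (x # xs)) $ x = f $ x"
    by (simp add: vector_matrix_mult_def if_distrib[of "\<lambda>y. _ * y"] cong: if_cong
        del: word_rep.simps)
  then have x: "f $ x = 0"
    using Cons.prems(2) by simp
  then have "f v* gen_rep x = 0"
    by (simp add: gen_rep_def vector_rank_one inner_axis)
  then have "f v* word_rep xs = 0"
    using Cons.prems(2) by (simp add: vector_circle_absorb)
  then show ?case
    using Cons x by auto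
qed simp

end

text \<open>In dimension three there is a nonzero covector \<open>f\<close> orthogonal to the first two roots. It sees only the last
  reflection, so \<open>f C\<close> is a multiple of the last root.\<close>
lemma exists_covector_of_factorization:
  fixes A C :: "real^3^3"
  assumes "C = circle A (rank_one x x) (circle A (rank_one p p) (rank_one r r))"
    and nonsingular: "\<And>f. f v* C = 0 \<Longrightarrow> f = 0"
  obtains f k where "f \<bullet> x = 0" "k \<noteq> 0" "f v* C = k *\<^sub>R r"
proof -
  have "dim (span {x, p}) < DIM(real^3)"
    using dim_le_card[of "span {x, p}" "{x, p}"] card_insert_le_m1[of 2 "{p}" x] by simp
  then obtain f where f: "f \<noteq> 0" "span {x, p} \<subseteq> {y. f \<bullet> y = 0}"
    using lowdim_subset_hyperplane[of "span {x, p}"] by (auto simp: span_span)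
  then have orth: "f \<bullet> x = 0" "f \<bullet> p = 0"
    using span_base[of x "{x, p}"] span_base[of p "{x, p}"] by auto
  then have "f v* C = (f \<bullet> r) *\<^sub>R r"
    unfolding assms(1) by (simp add: vector_circle_absorb vector_rank_one)
  moreover from this have "f \<bullet> r \<noteq> 0"
    using nonsingular f(1) by force
  ultimately show ?thesis using that orth(1) by blast
qed

text \<open>If two factorizations of \<open>C\<close> into three reflections share the last one, the covectors \<open>f\<close> and \<open>f'\<close>
  attached to them have proportional images under the injective map \<open>C\<close>, so they are proportional.
  Hence \<open>f\<close> is orthogonal to both first roots \<open>x\<close> and \<open>y\<close>, that is, a multiple of their cross
  product. This determines the line of the last root from \<open>x\<close>, \<open>y\<close> and \<open>C\<close> alone.\<close>
lemma last_root_of_two_factorizations: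
  fixes A C :: "real^3^3"
  assumes "C = circle A (rank_one x x) (circle A (rank_one p p) (rank_one r r))"
    and "C = circle A (rank_one y y) (circle A (rank_one q q) (rank_one r r))"
    and nonsingular: "\<And>f. f v* C = 0 \<Longrightarrow> f = 0"
    and "r \<noteq> 0" "cross3 x y \<noteq> 0"
  obtains k where "k \<noteq> 0" "r = k *\<^sub>R (cross3 x y v* C)"
proof -
  obtain f k where f: "f \<bullet> x = 0" "k \<noteq> 0" "f v* C = k *\<^sub>R r"
    using exists_covector_of_factorization[OF assms(1) nonsingular] by blast
  obtain f' k' where f': "f' \<bullet> y = 0" "k' \<noteq> 0" "f' v* C = k' *\<^sub>R r"
    using exists_covector_of_factorization[OF assms(2) nonsingular] by blast
  have "(k' *\<^sub>R f - k *\<^sub>R f') v* C = 0"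
    using f(3) f'(3) by (simp add: vector_matrix_mult_diff_distrib scaleR_vector_matrix_assoc)
  then have "k' *\<^sub>R f = k *\<^sub>R f'"
    using nonsingular by force
  then have "k' * (f \<bullet> y) = 0"
    using f'(1) by (metis inner_scaleR_left mult_zero_right)
  then have "f \<bullet> y = 0"
    using f'(2) by simp
  then have "cross3 (cross3 x y) f = 0"
    using f(1) by (simp add: Lagrange cross_skew[of _ f] inner_commute)
  moreover have "f \<noteq> 0"
    using f(2,3) assms(4) by auto
  ultimately obtain l where l: "f = l *\<^sub>R cross3 x y"
    using assms(5) unfolding cross_eq_0 collinear_lemma by auto
  then have "l \<noteq> 0" using \<open>f \<noteq> 0\<close> by auto
  have "k *\<^sub>R r = l *\<^sub>R (cross3 x y v* C)"
    using f(3) unfolding l by (simp add: scaleR_vector_matrix_assoc)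
  then have "r = (l / k) *\<^sub>R (cross3 x y v* C)"
    using f(2) by (metis divide_inverse_commute scaleR_one scaleR_scaleR left_inverse)
  then show ?thesis
    using that[of "l / k"] \<open>l \<noteq> 0\<close> f(2) by simp
qed

text \<open>This excludes a bowtie with lower elements \<open>s\<close>, \<open>t\<close> and upper elements \<open>u = s a = t b\<close> and
  \<open>u' = s a' = t b'\<close>: as \<open>c = u r = u' r'\<close>, equality of the complements gives \<open>u = u'\<close>.\<close>
lemma no_bowtie:
  fixes g :: "3 \<Rightarrow> 'a" and W (structure)
  assumes "indexed_coxeter_system W g m"
  defines "T \<equiv> reflections W (range g)"
  assumes "distinct is" "set is = UNIV"
    and c: "c = indexed_coxeter_system.word_prod W g is"
    and refl: "s \<in> T" "t \<in> T" "a \<in> T" "b \<in> T" "r \<in> T" "a' \<in> T" "b' \<in> T" "r' \<in> T"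
    and "s \<noteq> t"
    and fac: "c = s \<otimes> (a \<otimes> r)" "c = t \<otimes> (b \<otimes> r)" "c = s \<otimes> (a' \<otimes> r')" "c = t \<otimes> (b' \<otimes> r')"
  shows "r = r'"
proof -
  interpret indexed_coxeter_system W g m by fact
  have root: "\<exists>x. x \<noteq> 0 \<and> rep z = rank_one x x" if "z \<in> T" for z
    using that reflection_root unfolding T_def by metis
  obtain x y p q r0 p' q' r0' where roots:
    "rep s = rank_one x x" "rep t = rank_one y y" "rep a = rank_one p p" "rep b = rank_one q q"
    "rep r = rank_one r0 r0" "rep a' = rank_one p' p'" "rep b' = rank_one q' q'"
    "rep r' = rank_one r0' r0'" and nonzero: "x \<noteq> 0" "y \<noteq> 0" "r0 \<noteq> 0" "r0' \<noteq> 0"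
    using refl[THEN root] by metis
  have closed: "z \<in> carrier W" if "z \<in> T" for z
    using that reflection_closed unfolding T_def by blast
  have rep3: "rep (u \<otimes> (v \<otimes> w)) = rep u \<odot> (rep v \<odot> rep w)" if "u \<in> T" "v \<in> T" "w \<in> T" for u v w
    using that[THEN closed] by (simp add: rep_mult)
  have nonsingular: "f = 0" if "f v* rep c = 0" for f
    using coxeter_word_nonsingular[OF \<open>distinct is\<close>, of f] that \<open>set is = UNIV\<close>
    by (simp add: c rep_word_prod vec_eq_iff)
  have independent: "cross3 x y \<noteq> 0"
  proof
    assume "cross3 x y = 0"
    then obtain k where "y = k *\<^sub>R x"
      using nonzero unfolding cross_eq_0 collinear_lemma by auto
    then have "t = s"
      using reflection_eqI[of t s y x k] roots refl nonzero by (auto simp: T_def)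
    then show False using \<open>s \<noteq> t\<close> by simp
  qed
  obtain k where k: "k \<noteq> 0" "r0 = k *\<^sub>R (cross3 x y v* rep c)"
    using last_root_of_two_factorizations[of "rep c" cartan x p r0 y q] nonsingular independent nonzero
      rep3[of s a r] rep3[of t b r] refl fac roots by metis
  obtain k' where k': "k' \<noteq> 0" "r0' = k' *\<^sub>R (cross3 x y v* rep c)"
    using last_root_of_two_factorizations[of "rep c" cartan x p' r0' y q'] nonsingular independent nonzero
      rep3[of s a' r'] rep3[of t b' r'] refl fac roots by metis
  have "r0 = (k / k') *\<^sub>R r0'"
    using k k' by simp
  then show ?thesis
    using reflection_eqI[of r r' r0 r0' "k / k'"] roots refl k(1) k'(1) by (simp add: T_def)
qed

section \<open>Reflection length and the absolute order\<close>

context indexed_coxeter_system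
begin

abbreviation len :: "'a \<Rightarrow> nat" where "len \<equiv> reflection_length W (range g)"

lemma reflections_factorization:
  assumes "x \<in> carrier W"
  shows "\<exists>ts \<in> lists T. length ts = len x \<and> list_product W ts = x"
proof -
  obtain "is" where "word_prod is = x"
    using word_prod_surj[OF assms] by blast
  then have "\<exists>ts \<in> lists T. length ts = length is \<and> list_product W ts = x"
    using generator_reflection unfolding word_prod_def by (intro bexI[of _ "map g is"]) auto
  then show ?thesis
    unfolding reflection_length_def by (rule LeastI)
qed

lemma len_le:
  assumes "ts \<in> lists T"
  shows "len (list_product W ts) \<le> length ts"
  unfolding reflection_length_def using assms by (intro Least_le) blast

lemma len_mult_le:
  assumes "x \<in> carrier W" "y \<in> carrier W"
  shows "len (x \<otimes> y) \<le> len x + len y"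
proof -
  obtain xs ys where "xs \<in> lists T" "ys \<in> lists T" "list_product W xs = x" "list_product W ys = y"
    "length xs = len x" "length ys = len y"
    using reflections_factorization[OF assms(1)] reflections_factorization[OF assms(2)] by blast
  moreover from this have "list_product W (xs @ ys) = x \<otimes> y"
    using reflection_closed list_product_append[of xs ys] by auto
  ultimately show ?thesis
    using len_le[of "xs @ ys"] by simp
qed

lemma len_one: "len \<one> = 0"
  using len_le[of "[]"] by (simp add: list_product_def)

lemma len_0D:
  assumes "x \<in> carrier W" "len x = 0"
  shows "x = \<one>"
  using reflections_factorization[OF assms(1)] assms(2) by (auto simp: list_product_def)

lemma len_1D:
  assumes "x \<in> carrier W" "len x = 1"
  shows "x \<in> T"
  using reflections_factorization[OF assms(1)] assms(2) reflection_closed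
  by (auto simp: list_product_def length_Suc_conv)

lemma absolute_order:
  "partial_order (absolute_interval W (range g) c)"
proof -
  have refl: "absolute_le W (range g) x x" if "x \<in> carrier W" for x
    using that by (simp add: absolute_le_def len_one)
  have antisym: "x = y" if "x \<in> carrier W" "y \<in> carrier W"
    "absolute_le W (range g) x y" "absolute_le W (range g) y x" for x y
  proof -
    have "len (inv x \<otimes> y) = 0"
      using that unfolding absolute_le_def by linarith
    then have "inv x \<otimes> y = \<one>"
      using that by (intro len_0D) auto
    then show ?thesis
      using that by (metis inv_closed inv_equality inv_inv)
  qed
  have trans: "absolute_le W (range g) x z" if "x \<in> carrier W" "y \<in> carrier W" "z \<in> carrier W"
    "absolute_le W (range g) x y" "absolute_le W (range g) y z" for x y z
  proof -
    have "x \<otimes> (inv x \<otimes> z) = z" "(inv x \<otimes> y) \<otimes> (inv y \<otimes> z) = inv x \<otimes> z"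
      using that by (simp_all add: m_assoc inv_solve_left flip: m_assoc[of y] m_assoc[of x])
    then show ?thesis
      using that len_mult_le[of x "inv x \<otimes> z"] len_mult_le[of "inv x \<otimes> y" "inv y \<otimes> z"]
      unfolding absolute_le_def by simp
  qed
  show ?thesis
    by unfold_locales (auto simp: absolute_interval_def intro: refl antisym trans)
qed

end

section \<open>The lattice property\<close>

text \<open>An upper bound of \<open>x\<close> and \<open>y\<close> of minimal rank is least: interpolating between it and any other
  upper bound gives an upper bound below both, which by minimality is the chosen one. Dually for
  lower bounds of maximal rank.\<close>
lemma lattice_of_interpolation:
  fixes L :: "('a, 'b) gorder_scheme" (structure) and rk :: "'a \<Rightarrow> nat" and lo hi :: 'a
  assumes "partial_order L"
    and lo: "lo \<in> carrier L" "\<And>x. x \<in> carrier L \<Longrightarrow> lo \<sqsubseteq> x"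
    and hi: "hi \<in> carrier L" "\<And>x. x \<in> carrier L \<Longrightarrow> x \<sqsubseteq> hi"
    and rk: "\<And>x y. \<lbrakk>x \<in> carrier L; y \<in> carrier L; x \<sqsubseteq> y; x \<noteq> y\<rbrakk> \<Longrightarrow> rk x < rk y"
    and interpolation: "\<And>x y u v. \<lbrakk>x \<in> carrier L; y \<in> carrier L; u \<in> carrier L; v \<in> carrier L;
      x \<sqsubseteq> u; x \<sqsubseteq> v; y \<sqsubseteq> u; y \<sqsubseteq> v\<rbrakk> \<Longrightarrow> \<exists>z \<in> carrier L. x \<sqsubseteq> z \<and> y \<sqsubseteq> z \<and> z \<sqsubseteq> u \<and> z \<sqsubseteq> v"
  shows "lattice L"
proof -
  interpret partial_order L by fact
  show ?thesis
  proof (intro lattice.intro upper_semilattice.intro lower_semilattice.intro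
      upper_semilattice_axioms.intro lower_semilattice_axioms.intro \<open>partial_order L\<close>)
    fix x y assume xy: "x \<in> carrier L" "y \<in> carrier L"
    define ub where "ub u \<longleftrightarrow> u \<in> carrier L \<and> x \<sqsubseteq> u \<and> y \<sqsubseteq> u" for u
    have "ub hi" using xy hi by (simp add: ub_def)
    then obtain u where u: "ub u" "\<And>v. ub v \<Longrightarrow> rk u \<le> rk v"
      using ex_has_least_nat[of ub hi rk] by blast
    have "u \<sqsubseteq> v" if v: "ub v" for v
    proof -
      obtain z where z: "z \<in> carrier L" "x \<sqsubseteq> z" "y \<sqsubseteq> z" "z \<sqsubseteq> u" "z \<sqsubseteq> v"
        using interpolation[of x y u v] u(1) v xy unfolding ub_def by blast
      then have "z = u"
        using rk[of z u] u unfolding ub_def by fastforce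
      then show ?thesis using z by simp
    qed
    then show "\<exists>s. least L s (Upper L {x, y})"
      using u(1) xy unfolding least_def Upper_def ub_def by (intro exI[of _ u]) auto
  next
    fix x y assume xy: "x \<in> carrier L" "y \<in> carrier L"
    define lb where "lb u \<longleftrightarrow> u \<in> carrier L \<and> u \<sqsubseteq> x \<and> u \<sqsubseteq> y" for u
    have bound: "rk u \<le> rk x" if "lb u" for u
      using that rk[of u x] xy unfolding lb_def by fastforce
    have "lb lo" using xy lo by (simp add: lb_def)
    then obtain u where u: "lb u" "\<And>v. lb v \<Longrightarrow> rk v \<le> rk u"
      using ex_has_greatest_nat[of lb lo rk "Suc (rk x)"] bound by (meson less_Suc_eq_le)
    have "v \<sqsubseteq> u" if v: "lb v" for v
    proof -
      obtain z where z: "z \<in> carrier L" "u \<sqsubseteq> z" "v \<sqsubseteq> z" "z \<sqsubseteq> x" "z \<sqsubseteq> y"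
        using interpolation[of u v x y] u(1) v xy unfolding lb_def by blast
      then have "z = u"
        using rk[of u z] u unfolding lb_def by fastforce
      then show ?thesis using z by simp
    qed
    then show "\<exists>s. greatest L s (Lower L {x, y})"
      using u(1) xy unfolding greatest_def Lower_def lb_def by (intro exI[of _ u]) auto
  qed
qed

text \<open>Interpolation is trivial when two of the lower or two of the upper elements are comparable.
  Otherwise none of the four is \<open>lo\<close> or \<open>hi\<close>, which in rank three leaves two elements of rank one
  below two elements of rank two.\<close>
lemma lattice_of_rank_three:
  fixes L :: "('a, 'b) gorder_scheme" (structure) and rk :: "'a \<Rightarrow> nat" and lo hi :: 'a
  assumes "partial_order L"
    and lo: "lo \<in> carrier L" "\<And>x. x \<in> carrier L \<Longrightarrow> lo \<sqsubseteq> x"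
    and hi: "hi \<in> carrier L" "\<And>x. x \<in> carrier L \<Longrightarrow> x \<sqsubseteq> hi"
    and rk: "\<And>x y. \<lbrakk>x \<in> carrier L; y \<in> carrier L; x \<sqsubseteq> y; x \<noteq> y\<rbrakk> \<Longrightarrow> rk x < rk y"
    and "rk hi \<le> 3"
    and bowtie: "\<And>x y u v. \<lbrakk>x \<in> carrier L; y \<in> carrier L; u \<in> carrier L; v \<in> carrier L;
      x \<sqsubseteq> u; x \<sqsubseteq> v; y \<sqsubseteq> u; y \<sqsubseteq> v; x \<noteq> y;
      rk x = 1; rk y = 1; rk u = 2; rk v = 2; rk hi = 3\<rbrakk> \<Longrightarrow> u = v"
  shows "lattice L"
proof (rule lattice_of_interpolation[OF assms(1) lo hi rk])
  interpret partial_order L by fact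
  fix x y u v
  assume carr: "x \<in> carrier L" "y \<in> carrier L" "u \<in> carrier L" "v \<in> carrier L"
    and le: "x \<sqsubseteq> u" "x \<sqsubseteq> v" "y \<sqsubseteq> u" "y \<sqsubseteq> v"
  show "\<exists>z \<in> carrier L. x \<sqsubseteq> z \<and> y \<sqsubseteq> z \<and> z \<sqsubseteq> u \<and> z \<sqsubseteq> v"
  proof (cases "x \<sqsubseteq> y \<or> y \<sqsubseteq> x \<or> u \<sqsubseteq> v \<or> v \<sqsubseteq> u")
    case True
    then show ?thesis using carr le le_refl by blast
  next
    case False
    have ranks: "rk z = 1 \<and> rk w = 2 \<and> rk hi = 3"
      if "z \<in> {x, y}" "w \<in> {u, v}" for z w
    proof -
      have *: "z \<in> carrier L" "w \<in> carrier L" "z \<sqsubseteq> w" "z \<noteq> lo" "w \<noteq> hi" "z \<noteq> w"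
        using that carr le False lo hi by auto
      then show ?thesis
        using rk[of lo z] rk[of z w] rk[of w hi] lo hi \<open>rk hi \<le> 3\<close> by force
    qed
    then have "u = v"
      using bowtie[OF carr le] False carr(1) le_refl by auto
    then show ?thesis using False carr(3) by simp
  qed
qed

theorem theorem1p4:
  fixes W :: "('a, 'b) monoid_scheme" and S :: "'a set" and c :: 'a
  assumes "coxeter_system W S"
    and "card S = 3"
    and "coxeter_element W S c"
  shows "lattice (absolute_interval W S c)"
proof -
  obtain m where m: "coxeter_matrix S m" "has_presentation W S (coxeter_relators S m)"
    using assms(1) unfolding coxeter_system_def coxeter_system_axioms_def by blast
  have "group W"
    using assms(1) by (simp add: coxeter_system_def)
  obtain ss where ss: "distinct ss" "set ss = S" "list_product W ss = c"
    using assms(3) unfolding coxeter_element_def by blast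
  have "finite S" "card S = CARD(3)"
    using assms(2) by (auto intro: card_ge_0_finite)
  then obtain g :: "3 \<Rightarrow> 'a" where g: "bij_betw g UNIV S"
    using finite_same_card_bij[of "UNIV :: 3 set" S] by auto
  then have range: "range g = S" and inj: "inj g"
    by (auto simp: bij_betw_def)
  interpret indexed_coxeter_system W g m
    using \<open>group W\<close> m inj unfolding range[symmetric]
    by (simp add: indexed_coxeter_system_def indexed_coxeter_system_axioms_def)
  define js where "js = map (the_inv g) ss"
  have "map g js = ss"
    unfolding js_def map_map using ss(2) range
    by (intro map_idI) (auto simp: f_the_inv_into_f[OF inj])
  then have js: "word_prod js = c"
    using ss(3) by (simp add: word_prod_def)
  have distinct: "distinct js"
    using ss(1) \<open>map g js = ss\<close> distinct_map by metis
  have all: "set js = UNIV"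
    using ss(2) \<open>map g js = ss\<close> inj range by (metis inj_image_eq_iff list.set_map)
  have bowtie_free: "r = r'"
    if "s \<in> T" "t \<in> T" "a \<in> T" "b \<in> T" "r \<in> T" "a' \<in> T" "b' \<in> T" "r' \<in> T" "s \<noteq> t"
      "c = s \<otimes>\<^bsub>W\<^esub> (a \<otimes>\<^bsub>W\<^esub> r)" "c = t \<otimes>\<^bsub>W\<^esub> (b \<otimes>\<^bsub>W\<^esub> r)"
      "c = s \<otimes>\<^bsub>W\<^esub> (a' \<otimes>\<^bsub>W\<^esub> r')" "c = t \<otimes>\<^bsub>W\<^esub> (b' \<otimes>\<^bsub>W\<^esub> r')"
    for s t a b r a' b' r'
    by (rule no_bowtie[OF indexed_coxeter_system_axioms distinct all js[symmetric] that])
  have "c \<in> carrier W"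
    using js word_prod_closed by metis
  have "len c \<le> 3"
  proof -
    have "length ss = 3"
      using ss(1,2) assms(2) by (metis distinct_card)
    moreover have "ss \<in> lists T"
      using generator_reflection ss(2)[folded range] by (force simp: in_lists_conv_set)
    ultimately show ?thesis
      using len_le[of ss] ss(3) by simp
  qed
  let ?L = "absolute_interval W (range g) c"
  have carrier: "x \<in> carrier ?L \<longleftrightarrow> x \<in> carrier W \<and> len x + len (inv\<^bsub>W\<^esub> x \<otimes>\<^bsub>W\<^esub> c) = len c" for x
    by (simp add: absolute_interval_def absolute_le_def)
  have le: "x \<sqsubseteq>\<^bsub>?L\<^esub> y \<longleftrightarrow> len x + len (inv\<^bsub>W\<^esub> x \<otimes>\<^bsub>W\<^esub> y) = len y" for x y
    by (simp add: absolute_interval_def absolute_le_def)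
  have cancel: "x \<otimes>\<^bsub>W\<^esub> (inv\<^bsub>W\<^esub> x \<otimes>\<^bsub>W\<^esub> y) = y" if "x \<in> carrier W" "y \<in> carrier W" for x y
    using that by (simp flip: m_assoc)
  have "lattice ?L"
  proof (rule lattice_of_rank_three[where rk = len and lo = "\<one>\<^bsub>W\<^esub>" and hi = c])
    show "partial_order ?L" by (rule absolute_order)
    show "len x < len y" if "x \<in> carrier ?L" "y \<in> carrier ?L" "x \<sqsubseteq>\<^bsub>?L\<^esub> y" "x \<noteq> y" for x y
    proof (rule ccontr)
      assume "\<not> len x < len y"
      then have "inv\<^bsub>W\<^esub> x \<otimes>\<^bsub>W\<^esub> y = \<one>\<^bsub>W\<^esub>"
        using that by (intro len_0D) (auto simp: carrier le)
      then show False
        using that cancel[of x y] by (simp add: carrier)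
    qed
    show "u = v"
      if elems: "x \<in> carrier ?L" "y \<in> carrier ?L" "u \<in> carrier ?L" "v \<in> carrier ?L"
        and below: "x \<sqsubseteq>\<^bsub>?L\<^esub> u" "x \<sqsubseteq>\<^bsub>?L\<^esub> v" "y \<sqsubseteq>\<^bsub>?L\<^esub> u" "y \<sqsubseteq>\<^bsub>?L\<^esub> v" and "x \<noteq> y"
        and ranks: "len x = 1" "len y = 1" "len u = 2" "len v = 2" "len c = 3" for x y u v
    proof -
      have quotient: "inv\<^bsub>W\<^esub> z \<otimes>\<^bsub>W\<^esub> w \<in> T" if "z \<in> {x, y}" "w \<in> {u, v}" for z w
        using that elems below ranks by (intro len_1D) (auto simp: carrier le)
      have complement: "inv\<^bsub>W\<^esub> w \<otimes>\<^bsub>W\<^esub> c \<in> T" if "w \<in> {u, v}" for w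
        using that elems ranks \<open>c \<in> carrier W\<close> by (intro len_1D) (auto simp: carrier)
      have atoms: "z \<in> T" if "z \<in> {x, y}" for z
        using that elems ranks by (intro len_1D) (auto simp: carrier)
      have factor: "c = z \<otimes>\<^bsub>W\<^esub> ((inv\<^bsub>W\<^esub> z \<otimes>\<^bsub>W\<^esub> w) \<otimes>\<^bsub>W\<^esub> (inv\<^bsub>W\<^esub> w \<otimes>\<^bsub>W\<^esub> c))"
        if "z \<in> {x, y}" "w \<in> {u, v}" for z w
      proof -
        have "z \<in> carrier W" "w \<in> carrier W"
          using that elems by (auto simp: carrier)
        then show ?thesis
          using \<open>c \<in> carrier W\<close> by (simp add: m_assoc cancel)
      qed
      have "inv\<^bsub>W\<^esub> u \<otimes>\<^bsub>W\<^esub> c = inv\<^bsub>W\<^esub> v \<otimes>\<^bsub>W\<^esub> c"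
        by (rule bowtie_free[of x y "inv\<^bsub>W\<^esub> x \<otimes>\<^bsub>W\<^esub> u" "inv\<^bsub>W\<^esub> y \<otimes>\<^bsub>W\<^esub> u" _
              "inv\<^bsub>W\<^esub> x \<otimes>\<^bsub>W\<^esub> v" "inv\<^bsub>W\<^esub> y \<otimes>\<^bsub>W\<^esub> v"])
          (simp_all only: atoms quotient complement factor[symmetric] insertI1 insertI2
            \<open>x \<noteq> y\<close> not_False_eq_True)
      then show ?thesis
        using elems \<open>c \<in> carrier W\<close> by (auto simp: carrier dest: inj_onD[OF inv_inj])
    qed
  qed (use \<open>c \<in> carrier W\<close> \<open>len c \<le> 3\<close> in \<open>simp_all add: carrier le len_one\<close>)
  then show ?thesis
    by (simp add: range)
qed

end
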